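(* Let $(M,\mathcal{T},\Phi)$ be a weighted triangulated closed connected surface with $\chi(M)\le 0$ and a branch structure with orders $\beta=(\beta_1,\dots,\beta_N)^T$, and let $\alpha\ge0$. The branched $\alpha$-potential in $\mathbb{E}^2$, $$F^{\mathbb{E}}(u^{\mathbb{E}})=\int_{u_*^{\mathbb{E}}}^{u^{\mathbb{E}}}\sum_{i=1}^N\big((K_i+2\pi\beta_i)-s_\alpha^{\mathbb{E}}r_i^\alpha\big)\,\mathrm{d}u_i^{\mathbb{E}},\qquad u^{\mathbb{E}}\in\mathbb{R}^N,$$ is strictly convex in the hyperplane $U=\{u\in\mathbb{R}^N\mid\sum_iu_i=0\}\subset\mathbb{R}^N$.
   Context: $M$ is a closed connected surface with a triangulation $\mathcal{T}=\{V,E,F\}$, $V=\{v_1,\dots,v_N\}$, and a weight $\Phi:E\to[0,\pi/2]$, $\Phi_{ij}=\Phi(e_{ij})$. A circle packing metric is a function $r=(r_1,\dots,r_N)^T:V\to(0,+\infty)$. In Euclidean background geometry $\mathbb{E}^2$ the edge $e_{ij}$ has length $l_{ij}=\sqrt{r_i^2+r_j^2+2r_ir_j\cos\Phi_{ij}}$; each face $\Delta_{ijk}$ is then a Euclidean triangle, $\theta_i^{ijk}$ is its inner angle at $v_i$, and $K_i=2\pi-\sum_{f_{ijk}\in F}\theta_i^{ijk}$ (sum over all triangles having $v_i$ as a vertex). Branch structure: a (possibly empty) set $\{(b_1,\beta_1),\dots,(b_m,\beta_m)\}$ of distinct vertices with orders $\beta_j\in\mathbb{Z}_{>0}$; write $\beta_i$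 for the order at $v_i$, with $\beta_i=0$ if $v_i$ is not one of the $b_j$. It is a branch structure if each simple closed path $\Gamma=\{e_1,\dots,e_n\}$ in $\mathcal{T}$ satisfies $\sum_{j=1}^n[\pi-\Phi(e_j)]>2(l(\Gamma)+1)\pi$, where $l(\Gamma)$ is the sum of the orders of the branch points enclosed by $\Gamma$. Notation: $u_i^{\mathbb{E}}=\ln r_i$; $s_\alpha^{\mathbb{E}}=2\pi\chi(M)/\|r\|_\alpha^\alpha$ with $\|r\|_\alpha^\alpha=\sum_{i=1}^Nr_i^\alpha$; $u_*^{\mathbb{E}}\in\mathbb{R}^N$ is an arbitrarily chosen base point. The integral is the line integral of a (closed) 1-form on $\mathbb{R}^N$ along any path from $u_*^{\mathbb{E}}$ to $u^{\mathbb{E}}$. *)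

theory Defs
  imports "HOL-Analysis.Analysis"
begin

section \<open>Triangulated closed surfaces\<close>

definition closed_connected_surface :: "'m topology \<Rightarrow> bool" where
  "closed_connected_surface M \<longleftrightarrow>
     compact_space M \<and> connected_space M \<and> Hausdorff_space M \<and>
     (\<forall>x\<in>topspace M. \<exists>U W. openin M U \<and> x \<in> U \<and> open W \<and>
        subtopology M U homeomorphic_space top_of_set (W :: (real^2) set))"

text \<open>The vertices \<open>v\<^sub>1, \<dots>, v\<^sub>N\<close> are the elements of a finite type \<open>'v\<close>, so that
  \<open>real^'v\<close> is the space \<open>\<real>\<^sup>N\<close> of functions on the vertices. A triangulation \<open>{V,E,F}\<close> is
  given by its set \<open>F\<close> of faces, each a set of three vertices, which determines the edges.
  The simplex spanned by a set of vertices is realised in \<open>real^'v\<close> on the unit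
  coordinate vectors.\<close>

definition edges :: "'v set set \<Rightarrow> 'v set set" where
  "edges F = {e. card e = 2 \<and> (\<exists>f\<in>F. e \<subseteq> f)}"

definition face_simplex :: "'v set \<Rightarrow> (real^'v::finite) set" where
  "face_simplex s = convex hull ((\<lambda>i. axis i 1) ` s)"

definition surface_triangulation ::
    "'m topology \<Rightarrow> 'v::finite set set \<Rightarrow> (real^'v \<Rightarrow> 'm) \<Rightarrow> bool" where
  "surface_triangulation M F h \<longleftrightarrow>
     (\<forall>f\<in>F. card f = 3) \<and> \<Union>F = UNIV \<and>
     homeomorphic_map (top_of_set (\<Union>f\<in>F. face_simplex f)) M h"

definition euler_char :: "'v set set \<Rightarrow> int" where
  "euler_char F = int (card (\<Union>F)) - int (card (edges F)) + int (card F)"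

definition weight :: "'v set set \<Rightarrow> ('v set \<Rightarrow> real) \<Rightarrow> bool" where
  "weight F \<Phi> \<longleftrightarrow> (\<forall>e\<in>edges F. 0 \<le> \<Phi> e \<and> \<Phi> e \<le> pi / 2)"

section \<open>Branch structures\<close>

text \<open>A simple closed path is given by the list of the distinct vertices it runs through;
  its \<open>j\<close>-th edge is \<open>path_edge p j\<close> for \<open>j < length p\<close>, the last one leading back to the
  first vertex.\<close>

definition path_edge :: "'v list \<Rightarrow> nat \<Rightarrow> 'v set" where
  "path_edge p j = {p ! j, p ! (Suc j mod length p)}"

definition simple_closed_path :: "'v set set \<Rightarrow> 'v list \<Rightarrow> bool" where
  "simple_closed_path F p \<longleftrightarrow>
     3 \<le> length p \<and> distinct p \<and> (\<forall>j<length p. path_edge p j \<in> edges F)"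

text \<open>A vertex is enclosed by a simple closed path if it lies in the interior of a closed
  disc in \<open>M\<close> whose boundary circle is the path. On surfaces other than the sphere there is
  at most one such disc; a path that bounds no disc encloses no vertex.\<close>

definition encloses ::
    "'m topology \<Rightarrow> (real^'v::finite \<Rightarrow> 'm) \<Rightarrow> 'v list \<Rightarrow> 'v \<Rightarrow> bool" where
  "encloses M h p v \<longleftrightarrow>
     (\<exists>d. embedding_map (top_of_set (cball (0::real^2) 1)) M d \<and>
          d ` sphere 0 1 = h ` (\<Union>j<length p. face_simplex (path_edge p j)) \<and>
          h (axis v 1) \<in> d ` ball 0 1)"

text \<open>The branch points are the vertices \<open>v\<close> with \<open>\<beta> v > 0\<close>.\<close>

definition branch_structure ::
    "'m topology \<Rightarrow> 'v::finite set set \<Rightarrow> (real^'v \<Rightarrow> 'm) \<Rightarrow> ('v set \<Rightarrow> real) \<Rightarrow> ('v \<Rightarrow> nat) \<Rightarrow> bool"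
  where
  "branch_structure M F h \<Phi> \<beta> \<longleftrightarrow>
     (\<forall>p. simple_closed_path F p \<longrightarrow>
        (\<Sum>j<length p. pi - \<Phi> (path_edge p j))
          > 2 * (real (\<Sum>v\<in>{v. 0 < \<beta> v \<and> encloses M h p v}. \<beta> v) + 1) * pi)"

section \<open>Circle packing metrics in Euclidean background geometry\<close>

definition edge_length :: "('v set \<Rightarrow> real) \<Rightarrow> real^'v::finite \<Rightarrow> 'v \<Rightarrow> 'v \<Rightarrow> real" where
  "edge_length \<Phi> r i j = sqrt ((r$i)\<^sup>2 + (r$j)\<^sup>2 + 2 * r$i * r$j * cos (\<Phi> {i, j}))"

text \<open>The inner angle at the vertex \<open>i\<close> of the Euclidean triangle with the given side lengths,
  by the law of cosines.\<close>

definition inner_angle :: "('v set \<Rightarrow> real) \<Rightarrow> real^'v::finite \<Rightarrow> 'v \<Rightarrow> 'v \<Rightarrow> 'v \<Rightarrow> real" where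
  "inner_angle \<Phi> r i j k =
     arccos (((edge_length \<Phi> r i j)\<^sup>2 + (edge_length \<Phi> r i k)\<^sup>2 - (edge_length \<Phi> r j k)\<^sup>2)
             / (2 * edge_length \<Phi> r i j * edge_length \<Phi> r i k))"

text \<open>\<open>inner_angle \<Phi> r i j k\<close> is symmetric in \<open>j\<close> and \<open>k\<close>, so it depends only on \<open>i\<close> and the
  face \<open>{i, j, k}\<close>.\<close>

definition face_angle :: "('v set \<Rightarrow> real) \<Rightarrow> real^'v::finite \<Rightarrow> 'v set \<Rightarrow> 'v \<Rightarrow> real" where
  "face_angle \<Phi> r f i = (THE \<theta>. \<exists>j k. f = {i, j, k} \<and> \<theta> = inner_angle \<Phi> r i j k)"

definition curvature :: "'v::finite set set \<Rightarrow> ('v set \<Rightarrow> real) \<Rightarrow> real^'v \<Rightarrow> 'v \<Rightarrow> real" where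
  "curvature F \<Phi> r i = 2 * pi - (\<Sum>f\<in>{f\<in>F. i \<in> f}. face_angle \<Phi> r f i)"

definition s_alpha :: "'v::finite set set \<Rightarrow> real \<Rightarrow> real^'v \<Rightarrow> real" where
  "s_alpha F \<alpha> r = 2 * pi * of_int (euler_char F) / (\<Sum>i\<in>UNIV. r$i powr \<alpha>)"

section \<open>The branched potential\<close>

definition radii :: "real^'v::finite \<Rightarrow> real^'v" where
  "radii u = (\<chi> i. exp (u$i))"

definition potential_form ::
    "'v::finite set set \<Rightarrow> ('v set \<Rightarrow> real) \<Rightarrow> ('v \<Rightarrow> nat) \<Rightarrow> real \<Rightarrow> real^'v \<Rightarrow> real^'v" where
  "potential_form F \<Phi> \<beta> \<alpha> u =
     (\<chi> i. (curvature F \<Phi> (radii u) i + 2 * pi * real (\<beta> i))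
            - s_alpha F \<alpha> (radii u) * (radii u $ i) powr \<alpha>)"

definition has_line_integral ::
    "(real^'v::finite \<Rightarrow> real^'v) \<Rightarrow> real \<Rightarrow> (real \<Rightarrow> real^'v) \<Rightarrow> bool" where
  "has_line_integral \<omega> y g \<longleftrightarrow>
     ((\<lambda>t. \<omega> (g t) \<bullet> vector_derivative g (at t within {0..1})) has_integral y) {0..1}"

text \<open>The common value of the line integrals along all piecewise continuously differentiable
  paths from \<open>u0\<close> to \<open>u\<close>. The definite description is meaningful because the form is closed.\<close>

definition branched_potential ::
    "'v::finite set set \<Rightarrow> ('v set \<Rightarrow> real) \<Rightarrow> ('v \<Rightarrow> nat) \<Rightarrow> real \<Rightarrow> real^'v \<Rightarrow> real^'v \<Rightarrow> real" where
  "branched_potential F \<Phi> \<beta> \<alpha> u0 u =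
     (THE y. \<forall>g. valid_path g \<and> pathstart g = u0 \<and> pathfinish g = u \<longrightarrow>
                 has_line_integral (potential_form F \<Phi> \<beta> \<alpha>) y g)"

definition zero_sum_hyperplane :: "(real^'v::finite) set" where
  "zero_sum_hyperplane = {u. (\<Sum>i\<in>UNIV. u$i) = 0}"

definition strictly_convex_on :: "'a::real_vector set \<Rightarrow> ('a \<Rightarrow> real) \<Rightarrow> bool" where
  "strictly_convex_on S f \<longleftrightarrow> convex S \<and>
     (\<forall>x\<in>S. \<forall>y\<in>S. \<forall>t. x \<noteq> y \<and> 0 < t \<and> t < 1 \<longrightarrow>
        f ((1 - t) *\<^sub>R x + t *\<^sub>R y) < (1 - t) * f x + t * f y)"

end

theory Submission
  imports Defs
begin

text \<open>Write \<open>x, y, z\<close> for the cosines of the weights of the edges opposite to the vertices with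
  radii \<open>a, b, c\<close>. In the coordinates \<open>u = ln r\<close> the angle at \<open>a\<close> has differential
  \<open>w\<^sub>a\<^sub>b (du\<^sub>b - du\<^sub>a) + w\<^sub>a\<^sub>c (du\<^sub>c - du\<^sub>a)\<close> with symmetric weights \<open>w \<ge> 0\<close>, so each triangle
  contributes a weighted graph Laplacian to the Hessian of the potential. At most one of the three
  weights of a triangle vanishes (two tangent circles, both orthogonal to the third), hence the
  kernel of its Laplacian consists of the vectors that are constant on its vertices. As the
  surface is connected, only constant vectors lie in all these kernels, and the zero-sum hyperplane
  contains no such vector but 0. The remaining term is a nonnegative multiple of the softmax form,
  whose derivative is a covariance and thus positive semidefinite.\<close>

section \<open>Angles of one triangle and their logarithmic differentials\<close>

text \<open>Four times the squared area of the triangle, expanded so that its positivity is visible.\<close>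

definition tri_gram :: "real \<Rightarrow> real \<Rightarrow> real \<Rightarrow> real \<Rightarrow> real \<Rightarrow> real \<Rightarrow> real" where
  "tri_gram a b c x y z =
     a\<^sup>2 * b\<^sup>2 * (1 - z\<^sup>2) + b\<^sup>2 * c\<^sup>2 * (1 - x\<^sup>2) + c\<^sup>2 * a\<^sup>2 * (1 - y\<^sup>2)
     + 2 * a * b * c * (a * (x + y * z) + b * (y + x * z) + c * (z + x * y))"

text \<open>The coefficient of \<open>du_b\<close> in the differential of the angle at
  \<open>a\<close>. Geometrically it is the distance from the edge \<open>ab\<close> to the radical
  center of the three circles, divided by the length of that edge.\<close>

definition tri_weight :: "real \<Rightarrow> real \<Rightarrow> real \<Rightarrow> real \<Rightarrow> real \<Rightarrow> real \<Rightarrow> real" where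
  "tri_weight a b c x y z =
     (a\<^sup>2 * b\<^sup>2 * (1 - z\<^sup>2) + a * b * c * (a * (x + y * z) + b * (y + x * z)))
     / (sqrt (tri_gram a b c x y z) * (a\<^sup>2 + b\<^sup>2 + 2 * a * b * z))"

definition tri_angle :: "real \<Rightarrow> real \<Rightarrow> real \<Rightarrow> real \<Rightarrow> real \<Rightarrow> real \<Rightarrow> real" where
  "tri_angle a b c x y z =
     arccos ((a\<^sup>2 + a * b * z + a * c * y - b * c * x)
             / (sqrt (a\<^sup>2 + b\<^sup>2 + 2 * a * b * z) * sqrt (a\<^sup>2 + c\<^sup>2 + 2 * a * c * y)))"

lemma tri_gram_swap: "tri_gram a c b x z y = tri_gram a b c x y z"
  by (simp add: tri_gram_def algebra_simps)

lemma tri_gram_swap': "tri_gram b a c y x z = tri_gram a b c x y z"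
  by (simp add: tri_gram_def algebra_simps)

text \<open>The angles at both ends of an edge share its weight. This symmetry is what makes the
  angle form of a face closed.\<close>

lemma tri_weight_swap: "tri_weight b a c y x z = tri_weight a b c x y z"
  by (simp add: tri_weight_def tri_gram_swap' algebra_simps)

text \<open>The Gram determinant of the two edge vectors issuing from \<open>a\<close>; the
  subtracted square is that of their inner product.\<close>

lemma tri_gram_eq:
  "tri_gram a b c x y z = (a\<^sup>2 + b\<^sup>2 + 2 * a * b * z) * (a\<^sup>2 + c\<^sup>2 + 2 * a * c * y)
     - (a\<^sup>2 + a * b * z + a * c * y - b * c * x)\<^sup>2"
  by (simp add: tri_gram_def algebra_simps power2_eq_square)

context
  fixes a b c x y z :: real
  assumes pos: "0 < a" "0 < b" "0 < c"
    and cosines: "0 \<le> x" "x \<le> 1" "0 \<le> y" "y \<le> 1" "0 \<le> z" "z \<le> 1"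
begin

text \<open>No summand is negative, and \<open>z\<close> decides which one is positive: the term in
  \<open>1 - z\<^sup>2\<close> if \<open>z < 1\<close>, the term in \<open>c * (z + x * y)\<close>
  if \<open>z = 1\<close>.\<close>

lemma tri_gram_pos: "0 < tri_gram a b c x y z"
proof -
  have sq: "0 \<le> 1 - x\<^sup>2" "0 \<le> 1 - y\<^sup>2" "0 \<le> 1 - z\<^sup>2"
    using cosines by (simp_all add: power_le_one)
  have n1: "0 \<le> b\<^sup>2 * c\<^sup>2 * (1 - x\<^sup>2) + c\<^sup>2 * a\<^sup>2 * (1 - y\<^sup>2)"
    and n2: "0 \<le> a\<^sup>2 * b\<^sup>2 * (1 - z\<^sup>2)"
    and n3: "0 \<le> 2 * a * b * c * (a * (x + y * z) + b * (y + x * z) + c * (z + x * y))"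
    using pos cosines sq by simp_all
  show ?thesis
  proof (cases "z = 1")
    case True
    then have "0 < c * (z + x * y)" "0 \<le> a * (x + y * z)" "0 \<le> b * (y + x * z)"
      using pos cosines by (simp_all add: add_pos_nonneg)
    then have "0 < a * (x + y * z) + b * (y + x * z) + c * (z + x * y)"
      by linarith
    then have "0 < 2 * a * b * c * (a * (x + y * z) + b * (y + x * z) + c * (z + x * y))"
      using pos by simp
    then show ?thesis
      using n1 n2 unfolding tri_gram_def by linarith
  next
    case False
    then have "z\<^sup>2 < 1"
      using cosines by (simp add: power_less_one_iff)
    then have "0 < a\<^sup>2 * b\<^sup>2 * (1 - z\<^sup>2)"
      using pos by simp
    then show ?thesis
      using n1 n3 unfolding tri_gram_def by linarith
  qed
qed

lemma edge_sq_pos: "0 < a\<^sup>2 + b\<^sup>2 + 2 * a * b * z"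
  using pos cosines by (simp add: add_pos_nonneg)

lemma tri_weight_nonneg: "0 \<le> tri_weight a b c x y z"
  using pos cosines tri_gram_pos edge_sq_pos
  by (simp add: tri_weight_def power_le_one)

text \<open>The numerator is a sum of nonnegative terms, so each vanishes: the first forces tangency
  along \<open>ab\<close>, and then the others leave \<open>x + y = 0\<close>.\<close>

lemma tri_weight_eq_0:
  assumes "tri_weight a b c x y z = 0"
  shows "z = 1" "x = 0" "y = 0"
proof -
  have sq: "0 \<le> a\<^sup>2 * b\<^sup>2 * (1 - z\<^sup>2)"
    using cosines by (simp add: power_le_one)
  have s: "0 \<le> a * (x + y * z)" "0 \<le> b * (y + x * z)"
    using pos cosines by simp_all
  have "a\<^sup>2 * b\<^sup>2 * (1 - z\<^sup>2) + a * b * c * (a * (x + y * z) + b * (y + x * z)) = 0"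
    using assms tri_gram_pos edge_sq_pos unfolding tri_weight_def by simp
  moreover have "0 \<le> a * b * c * (a * (x + y * z) + b * (y + x * z))"
    using s pos by simp
  ultimately have "a\<^sup>2 * b\<^sup>2 * (1 - z\<^sup>2) = 0"
    and z: "a * b * c * (a * (x + y * z) + b * (y + x * z)) = 0"
    using sq by linarith+
  then have "z\<^sup>2 = 1"
    using pos by simp
  then show "z = 1"
    using cosines by (simp add: power2_eq_1_iff)
  have "a * (x + y * z) + b * (y + x * z) = 0"
    using z pos by simp
  then have "a * (x + y * z) = 0"
    using s by linarith
  then have "x + y = 0"
    using pos \<open>z = 1\<close> by simp
  then show "x = 0" "y = 0"
    using cosines by linarith+
qed

end

text \<open>Writing the derivatives as \<open>A u * A' v\<close> makes \<open>A'\<close>,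
  \<open>B'\<close>, \<open>C'\<close> differentials of logarithms. The angle is invariant under
  scaling, so only their differences survive. Radii are arbitrary functions so that the rule serves
  all three vertices of a face.\<close>

lemma tri_angle_has_derivative:
  fixes A B C :: "'a::real_normed_vector \<Rightarrow> real"
  assumes "(A has_derivative (\<lambda>v. A u * A' v)) (at u)"
    and "(B has_derivative (\<lambda>v. B u * B' v)) (at u)"
    and "(C has_derivative (\<lambda>v. C u * C' v)) (at u)"
    and pos: "0 < A u" "0 < B u" "0 < C u"
    and cosines: "0 \<le> x" "x \<le> 1" "0 \<le> y" "y \<le> 1" "0 \<le> z" "z \<le> 1"
  shows "((\<lambda>u. tri_angle (A u) (B u) (C u) x y z) has_derivative
          (\<lambda>v. tri_weight (A u) (B u) (C u) x y z * (B' v - A' v)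
             + tri_weight (A u) (C u) (B u) x z y * (C' v - A' v))) (at u)"
proof -
  let ?a = "A u" and ?b = "B u" and ?c = "C u"
  \<comment> \<open>\<open>P\<close> is the inner product of the edge vectors at \<open>a\<close>;
    \<open>Q\<close> and \<open>R\<close> are their squared lengths.\<close>
  define P where "P u = (A u)\<^sup>2 + A u * B u * z + A u * C u * y - B u * C u * x" for u
  define Q where "Q u = (A u)\<^sup>2 + (B u)\<^sup>2 + 2 * A u * B u * z" for u
  define R where "R u = (A u)\<^sup>2 + (C u)\<^sup>2 + 2 * A u * C u * y" for u
  define P' where "P' v = 2 * ?a\<^sup>2 * A' v + ?a * ?b * z * (A' v + B' v)
       + ?a * ?c * y * (A' v + C' v) - ?b * ?c * x * (B' v + C' v)" for v
  define Q' where "Q' v = 2 * ?a\<^sup>2 * A' v + 2 * ?b\<^sup>2 * B' v + 2 * ?a * ?b * z * (A' v + B' v)" for v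
  define R' where "R' v = 2 * ?a\<^sup>2 * A' v + 2 * ?c\<^sup>2 * C' v + 2 * ?a * ?c * y * (A' v + C' v)" for v
  note [derivative_intros] = assms(1-3)
  have dP [derivative_intros]: "(P has_derivative P') (at u)"
    unfolding P_def P'_def
    by (auto intro!: derivative_eq_intros simp: algebra_simps power2_eq_square)
  have dQ [derivative_intros]: "(Q has_derivative Q') (at u)"
    unfolding Q_def Q'_def
    by (auto intro!: derivative_eq_intros simp: algebra_simps power2_eq_square)
  have dR [derivative_intros]: "(R has_derivative R') (at u)"
    unfolding R_def R'_def
    by (auto intro!: derivative_eq_intros simp: algebra_simps power2_eq_square)
  let ?G = "tri_gram ?a ?b ?c x y z"
  have G: "0 < ?G" "?G = Q u * R u - (P u)\<^sup>2"
    using tri_gram_pos[OF pos cosines] by (simp_all add: tri_gram_eq P_def Q_def R_def)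
  have QR: "0 < Q u" "0 < R u"
    using edge_sq_pos[OF pos cosines] edge_sq_pos[of ?a ?c ?b x z y] pos cosines
    by (simp_all add: Q_def R_def)
  define X where "X u = P u / (sqrt (Q u) * sqrt (R u))" for u
  \<comment> \<open>Positivity of the Gram determinant keeps the cosine strictly between -1 and 1,
    where \<open>arccos\<close> is differentiable.\<close>
  have "(P u)\<^sup>2 < Q u * R u"
    using G by simp
  then have X2: "(X u)\<^sup>2 < 1"
    using QR by (simp add: X_def power_divide power_mult_distrib)
  then have X: "-1 < X u" "X u < 1"
    by (simp_all add: abs_square_less_1 abs_less_iff)
  have sq: "sqrt (1 - (X u)\<^sup>2) = sqrt ?G / (sqrt (Q u) * sqrt (R u))"
  proof -
    have "1 - (X u)\<^sup>2 = ?G / (Q u * R u)"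
      using QR by (simp add: X_def G(2) power_divide power_mult_distrib field_simps)
    then show ?thesis
      by (simp add: real_sqrt_divide real_sqrt_mult)
  qed
  let ?s = "sqrt (Q u)" and ?t = "sqrt (R u)"
  have s: "Q u = ?s * ?s" "R u = ?t * ?t" "?s \<noteq> 0" "?t \<noteq> 0"
    using QR by simp_all
  have ds: "((\<lambda>u. sqrt (Q u)) has_derivative (\<lambda>v. Q' v / (2 * ?s))) (at u)"
    "((\<lambda>u. sqrt (R u)) has_derivative (\<lambda>v. R' v / (2 * ?t))) (at u)"
    using has_derivative_real_sqrt[OF QR(1) dQ] has_derivative_real_sqrt[OF QR(2) dR]
    by (simp_all add: field_simps)
  have dX: "(X has_derivative
      (\<lambda>v. (P' v - P u / 2 * (Q' v / Q u + R' v / R u)) / (?s * ?t))) (at u)"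
  proof -
    \<comment> \<open>The quotient rule over plain reals, with \<open>S\<close> and \<open>T\<close>
      in place of the square roots, so that they act as atoms in the simplification.\<close>
    have *: "(p' * (S * T) - p * (S * (r' / (2 * T)) + q' / (2 * S) * T)) / ((S * T) * (S * T))
        = (p' - p / 2 * (q' / (S * S) + r' / (T * T))) / (S * T)"
      if "S \<noteq> 0" "T \<noteq> 0" for p p' q' r' S T :: real
      using that by (simp add: field_simps)
    have "(X has_derivative (\<lambda>v. (P' v * (?s * ?t) - P u * (?s * (R' v / (2 * ?t)) + Q' v / (2 * ?s) * ?t))
       / ((?s * ?t) * (?s * ?t)))) (at u)"
      unfolding X_def using s(3,4)
      by (intro has_derivative_divide' has_derivative_mult dP ds) auto
    then show ?thesis
      unfolding *[OF s(3,4)] s(1,2)[symmetric] .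
  qed
  have "((\<lambda>u. arccos (X u)) has_derivative
     (\<lambda>v. (P' v - P u / 2 * (Q' v / Q u + R' v / R u)) / (sqrt (Q u) * sqrt (R u))
           * inverse (- sqrt (1 - (X u)\<^sup>2)))) (at u)"
    using has_derivative_compose[OF dX DERIV_arccos[OF X, unfolded has_field_derivative_def]]
    by (simp add: mult.commute)
  moreover have "(P' v - P u / 2 * (Q' v / Q u + R' v / R u)) / (sqrt (Q u) * sqrt (R u))
           * inverse (- sqrt (1 - (X u)\<^sup>2))
      = tri_weight (A u) (B u) (C u) x y z * (B' v - A' v)
             + tri_weight (A u) (C u) (B u) x z y * (C' v - A' v)" (is "?L = ?R") for v
  proof -
    let ?N = "?a\<^sup>2 * ?b\<^sup>2 * (1 - z\<^sup>2) + ?a * ?b * ?c * (?a * (x + y * z) + ?b * (y + x * z))"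
    let ?N' = "?a\<^sup>2 * ?c\<^sup>2 * (1 - y\<^sup>2) + ?a * ?c * ?b * (?a * (x + z * y) + ?c * (z + x * y))"
    have alg: "- (- (N * d / q) - N' * d' / r) / g = N / (g * q) * d + N' / (g * r) * d'"
      if "q \<noteq> 0" "r \<noteq> 0" "g \<noteq> 0" for N d q N' d' r g :: real
      using that by (simp add: field_simps)
    have e1: "?L = - (P' v - P u / 2 * (Q' v / Q u + R' v / R u)) / sqrt ?G"
      using QR G unfolding sq by (simp add: field_simps)
    have e2: "P' v - P u / 2 * (Q' v / Q u + R' v / R u)
      = - (?N * (B' v - A' v) / Q u) - ?N' * (C' v - A' v) / R u"
    proof -
      \<comment> \<open>Cleared of the denominators \<open>Q u\<close> and \<open>R u\<close>, the
        claim is a polynomial identity in radii, cosines and logarithmic differentials.\<close>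
      have "P' v * (Q u * R u) - P u / 2 * (Q' v * R u + R' v * Q u)
        = - (?N * (B' v - A' v) * R u) - ?N' * (C' v - A' v) * Q u"
        unfolding P_def Q_def R_def P'_def Q'_def R'_def by algebra
      moreover have "p - P / 2 * (q / Q + r / R) = - (n / Q) - n' / R"
        if "Q \<noteq> 0" "R \<noteq> 0" "p * (Q * R) - P / 2 * (q * R + r * Q) = - (n * R) - n' * Q"
        for p q r n n' P Q R :: real
      proof -
        have "p - P / 2 * (q / Q + r / R) = (p * (Q * R) - P / 2 * (q * R + r * Q)) / (Q * R)"
          using that(1,2) by (simp add: field_simps)
        also have "\<dots> = (- (n * R) - n' * Q) / (Q * R)"
          by (simp only: that(3))
        finally show ?thesis
          using that(1,2) by (simp add: field_simps)
      qed
      ultimately show ?thesis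
        using QR by simp
    qed
    have e3: "- (- (?N * (B' v - A' v) / Q u) - ?N' * (C' v - A' v) / R u) / sqrt ?G
      = ?N / (sqrt ?G * Q u) * (B' v - A' v) + ?N' / (sqrt ?G * R u) * (C' v - A' v)"
      using QR G(1) by (intro alg) simp_all
    have w: "tri_weight ?a ?b ?c x y z = ?N / (sqrt ?G * Q u)"
      "tri_weight ?a ?c ?b x z y = ?N' / (sqrt ?G * R u)"
      by (simp_all only: tri_weight_def tri_gram_swap Q_def R_def)
    show ?thesis
      unfolding w e3[symmetric] e2[symmetric] by (rule e1)
  qed
  ultimately show ?thesis
    unfolding tri_angle_def X_def P_def Q_def R_def by simp
qed

section \<open>Closed 1-forms, their potentials, and convexity\<close>

text \<open>A 1-form is represented by a vector field via the inner product; symmetry of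
  \<open>D\<close> is closedness. \<open>D\<close> is an explicit argument because it becomes the
  Hessian of the potential, whose sign is studied later.\<close>

definition closed_form :: "('a::euclidean_space \<Rightarrow> 'a) \<Rightarrow> ('a \<Rightarrow> 'a \<Rightarrow> 'a) \<Rightarrow> bool" where
  "closed_form \<omega> D \<longleftrightarrow>
     (\<forall>x. (\<omega> has_derivative D x) (at x)) \<and>
     (\<forall>v. continuous_on UNIV (\<lambda>x. D x v)) \<and>
     (\<forall>x v w. D x v \<bullet> w = D x w \<bullet> v)"

lemma closed_form_const: "closed_form (\<lambda>x. c) (\<lambda>x v. 0)"
  by (simp add: closed_form_def)

lemma closed_form_add:
  "closed_form \<omega> D \<Longrightarrow> closed_form \<omega>' D' \<Longrightarrow>
    closed_form (\<lambda>x. \<omega> x + \<omega>' x) (\<lambda>x v. D x v + D' x v)"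
  unfolding closed_form_def
  by (simp add: inner_add_left has_derivative_add continuous_on_add)

lemma closed_form_scaleR:
  "closed_form \<omega> D \<Longrightarrow> closed_form (\<lambda>x. c *\<^sub>R \<omega> x) (\<lambda>x v. c *\<^sub>R D x v)"
  unfolding closed_form_def
  by (simp add: has_derivative_scaleR_right continuous_on_scaleR)

lemma closed_form_sum:
  "(\<And>i. i \<in> I \<Longrightarrow> closed_form (\<omega> i) (D i)) \<Longrightarrow>
    closed_form (\<lambda>x. \<Sum>i\<in>I. \<omega> i x) (\<lambda>x v. \<Sum>i\<in>I. D i x v)"
  unfolding closed_form_def
  by (simp add: inner_sum_left has_derivative_sum continuous_on_sum)

text \<open>The potential is the integral of \<open>\<omega>\<close> along rays; by symmetry of \<open>D\<close> the integrand of its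
  differential at \<open>x\<close> is the derivative of \<open>t \<omega>(t x) \<bullet> v\<close>.\<close>

lemma closed_form_potential:
  assumes "closed_form \<omega> D"
  obtains G where "\<And>x. (G has_derivative (\<lambda>v. \<omega> x \<bullet> v)) (at x)"
proof -
  have der: "(\<omega> has_derivative D x) (at x)" for x
    using assms by (simp add: closed_form_def)
  have cont: "continuous_on UNIV (\<lambda>x. D x v)" for v
    using assms by (simp add: closed_form_def)
  have sym: "D x v \<bullet> w = D x w \<bullet> v" for x v w
    using assms by (simp add: closed_form_def)
  have bl: "bounded_linear (D x)" for x
    using der has_derivative_bounded_linear by blast
  have cont\<omega>: "continuous_on UNIV \<omega>"
    by (rule has_derivative_continuous_on[OF der[THEN has_derivative_at_withinI]])
  \<comment> \<open>The derivative in \<open>x\<close> of the integrand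
    \<open>\<omega> (t *\<^sub>R x) \<bullet> x\<close>, packed as a bounded operator for
    differentiation under the integral sign.\<close>
  define B where "B x t = Blinfun (\<lambda>v. \<omega> (t *\<^sub>R x) \<bullet> v + (t *\<^sub>R D (t *\<^sub>R x) v) \<bullet> x)" for x and t :: real
  have blB: "bounded_linear (\<lambda>v. \<omega> (t *\<^sub>R x) \<bullet> v + (t *\<^sub>R D (t *\<^sub>R x) v) \<bullet> x)" for x t
    by (intro bounded_linear_add bounded_linear_inner_right bounded_linear_inner_left_comp
        bounded_linear_scaleR_right bounded_linear_const_scaleR bl)
  have B: "blinfun_apply (B x t) = (\<lambda>v. \<omega> (t *\<^sub>R x) \<bullet> v + (t *\<^sub>R D (t *\<^sub>R x) v) \<bullet> x)" for x t
    unfolding B_def using blB by (rule bounded_linear_Blinfun_apply)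
  have dB: "((\<lambda>x. \<omega> (t *\<^sub>R x) \<bullet> x) has_derivative B x t) (at x)" for x t
  proof -
    have "((\<lambda>x. \<omega> (t *\<^sub>R x)) has_derivative (\<lambda>v. D (t *\<^sub>R x) (t *\<^sub>R v))) (at x)"
      by (rule has_derivative_compose[OF _ der]) (auto intro!: derivative_eq_intros)
    then have "((\<lambda>x. \<omega> (t *\<^sub>R x) \<bullet> x) has_derivative
        (\<lambda>v. \<omega> (t *\<^sub>R x) \<bullet> v + D (t *\<^sub>R x) (t *\<^sub>R v) \<bullet> x)) (at x)"
      by (intro has_derivative_inner has_derivative_ident)
    then show ?thesis
      by (simp add: B bounded_linear.linear[OF bl] linear_cmul)
  qed
  \<comment> \<open>In finite dimension, continuity in operator norm can be tested on the basis
    vectors.\<close>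
  have contB: "continuous_on (UNIV \<times> cbox 0 1) (\<lambda>(x, t). B x t)"
  proof (rule continuous_on_blinfun_componentwise)
    fix i :: 'a
    have "continuous_on (UNIV \<times> cbox 0 (1::real)) (\<lambda>p. \<omega> (snd p *\<^sub>R fst p))"
      "continuous_on (UNIV \<times> cbox 0 (1::real)) (\<lambda>p. D (snd p *\<^sub>R fst p) i)"
      by (rule continuous_on_compose2[OF cont\<omega>] continuous_on_compose2[OF cont];
          auto intro!: continuous_intros)+
    then show "continuous_on (UNIV \<times> cbox 0 1) (\<lambda>p. blinfun_apply (case p of (x, t) \<Rightarrow> B x t) i)"
      by (simp add: B case_prod_unfold) (intro continuous_intros)
  qed
  define G where "G x = integral (cbox 0 1) (\<lambda>t::real. \<omega> (t *\<^sub>R x) \<bullet> x)" for x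
  have "(G has_derivative (\<lambda>v. \<omega> x \<bullet> v)) (at x)" for x
  proof -
    have "(G has_derivative integral (cbox 0 1) (B x)) (at x within UNIV)"
      unfolding G_def
    proof (rule leibniz_rule[OF _ _ contB])
      show "(\<lambda>t. \<omega> (t *\<^sub>R x) \<bullet> x) integrable_on cbox 0 1" for x
        by (intro integrable_continuous continuous_intros continuous_on_compose2[OF cont\<omega>]) auto
    qed (use dB in auto)
    moreover have "integral (cbox 0 1) (B x) v = \<omega> x \<bullet> v" for v
    proof -
      have cB: "continuous_on (cbox 0 1) (B x)"
        by (rule continuous_on_compose2[OF contB, of _ "\<lambda>t. (x, t)", simplified])
           (auto intro!: continuous_intros)
      have "((\<lambda>t. B x t v) has_integral (1 *\<^sub>R \<omega> (1 *\<^sub>R x) \<bullet> v - (0::real) *\<^sub>R \<omega> (0 *\<^sub>R x) \<bullet> v)) {0..1}"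
      proof (rule fundamental_theorem_of_calculus)
        fix t :: real
        have "((\<lambda>t. \<omega> (t *\<^sub>R x)) has_derivative (\<lambda>s. D (t *\<^sub>R x) (s *\<^sub>R x))) (at t)"
          by (rule has_derivative_compose[OF _ der]) (auto intro!: derivative_eq_intros)
        then have "((\<lambda>t. t *\<^sub>R \<omega> (t *\<^sub>R x) \<bullet> v) has_derivative
           (\<lambda>s. (t *\<^sub>R D (t *\<^sub>R x) (s *\<^sub>R x) + s *\<^sub>R \<omega> (t *\<^sub>R x)) \<bullet> v)) (at t)"
          by (auto intro!: derivative_eq_intros simp: inner_add_left)
        then have "((\<lambda>t. t *\<^sub>R \<omega> (t *\<^sub>R x) \<bullet> v) has_vector_derivative B x t v) (at t)"
          by (simp add: has_vector_derivative_def B bounded_linear.linear[OF bl] linear_cmul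
              inner_add_left inner_add_right algebra_simps sym[of _ x v])
        then show "((\<lambda>t. t *\<^sub>R \<omega> (t *\<^sub>R x) \<bullet> v) has_vector_derivative B x t v) (at t within {0..1})"
          by (rule has_vector_derivative_at_within)
      qed simp
      moreover have "((\<lambda>t. B x t v) has_integral integral (cbox 0 1) (B x) v) (cbox 0 1)"
        using has_integral_linear[OF integrable_integral[OF integrable_continuous[OF cB]],
            OF blinfun.bounded_linear_left[of v]]
        by (simp add: o_def)
      ultimately show ?thesis
        by (simp add: has_integral_unique)
    qed
    ultimately show ?thesis
      by (simp add: has_derivative_eq_rhs ext)
  qed
  then show thesis
    by (rule that)
qed

text \<open>By the chain rule the integrand is the derivative of \<open>G\<close> along
  \<open>g\<close> away from finitely many corners and the endpoints; there continuity suffices for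
  the fundamental theorem of calculus.\<close>

lemma has_line_integral_gradient:
  fixes \<omega> :: "real^'v::finite \<Rightarrow> real^'v"
  assumes G: "\<And>x. (G has_derivative (\<lambda>v. \<omega> x \<bullet> v)) (at x)"
    and "valid_path g"
  shows "has_line_integral \<omega> (G (pathfinish g) - G (pathstart g)) g"
proof -
  obtain S where g: "continuous_on {0..1} g" "finite S" "g C1_differentiable_on ({0..1} - S)"
    using assms(2) by (auto simp: valid_path_def piecewise_C1_differentiable_on_def)
  have "continuous_on UNIV G"
    by (rule has_derivative_continuous_on[OF G[THEN has_derivative_at_withinI]])
  then have "continuous_on {0..1} (\<lambda>t. G (g t))"
    by (rule continuous_on_compose2[OF _ g(1)]) auto
  moreover have "((\<lambda>t. G (g t)) has_vector_derivative
      \<omega> (g t) \<bullet> vector_derivative g (at t within {0..1})) (at t)" if t: "t \<in> {0<..<1} - S" for t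
  proof -
    have "g differentiable at t"
      using g(3) t by (auto simp: C1_differentiable_on_eq)
    then obtain d where d: "(g has_vector_derivative d) (at t)"
      using vector_derivative_works by blast
    then have "vector_derivative g (at t within {0..1}) = d"
      using t by (intro vector_derivative_at_within_ivl) auto
    moreover have "((\<lambda>t. G (g t)) has_derivative (\<lambda>s. \<omega> (g t) \<bullet> (s *\<^sub>R d))) (at t)"
      using has_derivative_compose[OF d[unfolded has_vector_derivative_def] G] .
    ultimately show ?thesis
      by (simp add: has_vector_derivative_def)
  qed
  ultimately show ?thesis
    unfolding has_line_integral_def pathfinish_def pathstart_def
    by (intro fundamental_theorem_of_calculus_interior_strong[OF g(2)]) auto
qed

text \<open>Existence is path independence; uniqueness needs one admissible path, for which the
  segment is taken.\<close>

lemma the_line_integral: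
  fixes \<omega> :: "real^'v::finite \<Rightarrow> real^'v"
  assumes G: "\<And>x. (G has_derivative (\<lambda>v. \<omega> x \<bullet> v)) (at x)"
  shows "(THE y. \<forall>g. valid_path g \<and> pathstart g = u0 \<and> pathfinish g = u \<longrightarrow>
            has_line_integral \<omega> y g) = G u - G u0"
proof (rule the_equality)
  show *: "\<forall>g. valid_path g \<and> pathstart g = u0 \<and> pathfinish g = u \<longrightarrow>
            has_line_integral \<omega> (G u - G u0) g"
    using has_line_integral_gradient[of G \<omega>] G by blast
  fix y
  assume "\<forall>g. valid_path g \<and> pathstart g = u0 \<and> pathfinish g = u \<longrightarrow> has_line_integral \<omega> y g"
  then have "has_line_integral \<omega> y (linepath u0 u)"
    by simp
  moreover have "has_line_integral \<omega> (G u - G u0) (linepath u0 u)"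
    using * by simp
  ultimately show "y = G u - G u0"
    unfolding has_line_integral_def by (rule has_integral_unique)
qed

text \<open>Along a segment in \<open>S\<close> the slope of \<open>G\<close> is strictly
  increasing. Only directions between points of \<open>S\<close> are tested, so the Hessian may
  degenerate transversally to \<open>S\<close>.\<close>

lemma strictly_convex_on_gradient:
  fixes \<omega> :: "'a::euclidean_space \<Rightarrow> 'a"
  assumes "convex S"
    and G: "\<And>x. (G has_derivative (\<lambda>v. \<omega> x \<bullet> v)) (at x)"
    and \<omega>: "\<And>x. (\<omega> has_derivative D x) (at x)"
    and pos: "\<And>x y z. x \<in> S \<Longrightarrow> y \<in> S \<Longrightarrow> x \<noteq> y \<Longrightarrow> 0 < D z (y - x) \<bullet> (y - x)"
  shows "strictly_convex_on S (\<lambda>x. G x - c)"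
  unfolding strictly_convex_on_def
proof (intro conjI ballI allI impI)
  fix x y and t :: real
  assume xy: "x \<in> S" "y \<in> S" and t: "x \<noteq> y \<and> 0 < t \<and> t < 1"
  let ?p = "\<lambda>s. x + s *\<^sub>R (y - x)"
  define f where "f s = G (?p s)" for s
  define f' where "f' s = \<omega> (?p s) \<bullet> (y - x)" for s
  have f: "(f has_real_derivative f' s) (at s)" for s
  proof -
    have "(?p has_derivative (\<lambda>r. r *\<^sub>R (y - x))) (at s)"
      by (auto intro!: derivative_eq_intros)
    from has_derivative_compose[OF this G] show ?thesis
      unfolding f_def f'_def has_field_derivative_def by (simp add: mult.commute[of _ "_ \<bullet> _"])
  qed
  have f': "(f' has_real_derivative D (?p s) (y - x) \<bullet> (y - x)) (at s)" for s
  proof -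
    have "linear (D (?p s))"
      using \<omega> bounded_linear.linear has_derivative_bounded_linear by blast
    moreover have "(?p has_derivative (\<lambda>r. r *\<^sub>R (y - x))) (at s)"
      by (auto intro!: derivative_eq_intros)
    from has_derivative_inner_left[OF has_derivative_compose[OF this \<omega>], of "y - x"]
    have "(f' has_derivative (\<lambda>r. D (?p s) (r *\<^sub>R (y - x)) \<bullet> (y - x))) (at s)"
      unfolding f'_def .
    ultimately show ?thesis
      unfolding has_field_derivative_def by (simp add: linear_cmul mult.commute[of _ "_ \<bullet> _"])
  qed
  have mono: "f' r < f' s" if "r < s" for r s
    using DERIV_pos_imp_increasing[OF that, of f'] f' pos xy t by blast
  \<comment> \<open>Mean slopes on the two sides of \<open>t\<close> are slopes at
    \<open>\<xi> < \<eta>\<close>; comparing them gives convexity at \<open>t\<close>.\<close>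
  obtain \<xi> where \<xi>: "0 < \<xi>" "\<xi> < t" "f t - f 0 = (t - 0) * f' \<xi>"
    using MVT2[of 0 t f f'] f t by auto
  obtain \<eta> where \<eta>: "t < \<eta>" "\<eta> < 1" "f 1 - f t = (1 - t) * f' \<eta>"
    using MVT2[of t 1 f f'] f t by auto
  have "(1 - t) * (f t - f 0) < t * (f 1 - f t)"
    using \<xi> \<eta> t mono[of \<xi> \<eta>] by (simp add: mult.left_commute)
  then have "f t < (1 - t) * f 0 + t * f 1"
    by (simp add: algebra_simps)
  then show "G ((1 - t) *\<^sub>R x + t *\<^sub>R y) - c < (1 - t) * (G x - c) + t * (G y - c)"
    by (simp add: f_def algebra_simps)
qed (fact assms(1))

section \<open>The angle form of a face\<close>

lemma continuous_on_tri_weight: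
  fixes A B C :: "'a::topological_space \<Rightarrow> real"
  assumes cont: "continuous_on S A" "continuous_on S B" "continuous_on S C"
    and pos: "\<And>u. 0 < A u" "\<And>u. 0 < B u" "\<And>u. 0 < C u"
    and cosines: "0 \<le> x" "x \<le> 1" "0 \<le> y" "y \<le> 1" "0 \<le> z" "z \<le> 1"
  shows "continuous_on S (\<lambda>u. tri_weight (A u) (B u) (C u) x y z)"
proof -
  have "tri_gram (A u) (B u) (C u) x y z \<noteq> 0" "(A u)\<^sup>2 + (B u)\<^sup>2 + 2 * A u * B u * z \<noteq> 0"
    for u
    using tri_gram_pos[OF pos[of u] cosines] edge_sq_pos[OF pos[of u] cosines]
    by simp_all
  moreover have "continuous_on S (\<lambda>u. tri_gram (A u) (B u) (C u) x y z)"
    unfolding tri_gram_def by (intro continuous_intros cont)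
  ultimately show ?thesis
    unfolding tri_weight_def by (intro continuous_intros cont) auto
qed

lemma radii_pos: "0 < radii u $ i"
  by (simp add: radii_def)

lemma radii_has_derivative: "((\<lambda>u. radii u $ i) has_derivative (\<lambda>v. radii u $ i * v $ i)) (at u)"
  unfolding radii_def
  by (auto intro!: derivative_eq_intros bounded_linear_imp_has_derivative[OF bounded_linear_vec_nth])

lemma continuous_on_radii: "continuous_on S (\<lambda>u. radii u $ i)"
  unfolding radii_def by (simp; intro continuous_intros)

text \<open>Nonnegative cosines keep the radicands nonnegative, so squaring removes the roots in the
  law of cosines; a common factor 2 then cancels.\<close>

lemma inner_angle_eq:
  fixes r :: "real^'v::finite"
  assumes r: "\<And>i. 0 < r $ i"
    and cosines: "0 \<le> cos (\<Phi> {i, j})" "0 \<le> cos (\<Phi> {i, k})" "0 \<le> cos (\<Phi> {j, k})"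
  shows "inner_angle \<Phi> r i j k =
    tri_angle (r $ i) (r $ j) (r $ k) (cos (\<Phi> {j, k})) (cos (\<Phi> {i, k})) (cos (\<Phi> {i, j}))"
proof -
  have sq: "(edge_length \<Phi> r p q)\<^sup>2 = (r $ p)\<^sup>2 + (r $ q)\<^sup>2 + 2 * r $ p * r $ q * cos (\<Phi> {p, q})"
    if "0 \<le> cos (\<Phi> {p, q})" for p q
    using that r by (simp add: edge_length_def add_nonneg_nonneg less_imp_le)
  have half: "2 * n / (2 * m * m') = n / (m * m')" for n m m' :: real
    by simp
  have "(edge_length \<Phi> r i j)\<^sup>2 + (edge_length \<Phi> r i k)\<^sup>2 - (edge_length \<Phi> r j k)\<^sup>2
    = 2 * ((r $ i)\<^sup>2 + r $ i * r $ j * cos (\<Phi> {i, j}) + r $ i * r $ k * cos (\<Phi> {i, k})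
        - r $ j * r $ k * cos (\<Phi> {j, k}))"
    by (simp add: sq cosines algebra_simps)
  then show ?thesis
    unfolding inner_angle_def tri_angle_def by (simp only: half) (simp only: edge_length_def)
qed

lemma inner_angle_commute: "inner_angle \<Phi> r i j k = inner_angle \<Phi> r i k j"
  by (simp add: inner_angle_def edge_length_def insert_commute algebra_simps)

text \<open>Distinctness determines the other two vertices up to order, and the angle ignores that
  order, so the description is unique.\<close>

lemma face_angle_eq:
  assumes "i \<noteq> j" "i \<noteq> k" "j \<noteq> k"
  shows "face_angle \<Phi> r {i, j, k} i = inner_angle \<Phi> r i j k"
  unfolding face_angle_def
proof (rule the_equality)
  fix \<theta>
  assume "\<exists>j' k'. {i, j, k} = {i, j', k'} \<and> \<theta> = inner_angle \<Phi> r i j' k'"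
  then obtain j' k' where eq: "{i, j, k} = {i, j', k'}" and \<theta>: "\<theta> = inner_angle \<Phi> r i j' k'"
    by blast
  from eq have "j' = j \<and> k' = k \<or> j' = k \<and> k' = j"
    using assms by (metis insertE insert_iff singletonD)
  then show "\<theta> = inner_angle \<Phi> r i j k"
    using \<theta> inner_angle_commute by metis
qed blast

text \<open>Extension by zero turns the sum over the faces at a vertex into a sum over all
  faces.\<close>

definition face_angles :: "('v set \<Rightarrow> real) \<Rightarrow> 'v set \<Rightarrow> real^'v::finite \<Rightarrow> real^'v" where
  "face_angles \<Phi> f u = (\<chi> i. if i \<in> f then face_angle \<Phi> (radii u) f i else 0)"

text \<open>The derivative is minus a weighted graph Laplacian on the triangle, hence symmetric and
  negative semidefinite; its null vectors are constant on the face.\<close>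

lemma face_angles_closed_form:
  fixes f :: "'v::finite set"
  assumes f: "card f = 3" and \<Phi>: "\<And>e. card e = 2 \<Longrightarrow> e \<subseteq> f \<Longrightarrow> 0 \<le> \<Phi> e \<and> \<Phi> e \<le> pi / 2"
  shows "\<exists>D. closed_form (face_angles \<Phi> f) D \<and> (\<forall>u v. D u v \<bullet> v \<le> 0) \<and>
    (\<forall>u v. D u v \<bullet> v = 0 \<longrightarrow> (\<forall>i\<in>f. \<forall>j\<in>f. v $ i = v $ j))"
proof -
  obtain i j k where fijk: "f = {i, j, k}" and d: "i \<noteq> j" "i \<noteq> k" "j \<noteq> k"
    using f by (auto simp: card_3_iff)
  define x y z where "x = cos (\<Phi> {j, k})" and "y = cos (\<Phi> {i, k})" and "z = cos (\<Phi> {i, j})"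
  have cosb: "0 \<le> cos (\<Phi> e) \<and> cos (\<Phi> e) \<le> 1" if "card e = 2" "e \<subseteq> f" for e
    using \<Phi>[OF that] by (auto intro!: cos_ge_zero)
  have c: "0 \<le> x" "x \<le> 1" "0 \<le> y" "y \<le> 1" "0 \<le> z" "z \<le> 1"
    using d fijk unfolding x_def y_def z_def by (auto simp: cosb)
  let ?a = "\<lambda>u. radii u $ i" and ?b = "\<lambda>u. radii u $ j" and ?c = "\<lambda>u. radii u $ k"
  \<comment> \<open>Each weight lists the ends of its edge first, then the third vertex, with the
    cosines permuted accordingly.\<close>
  define Wij Wik Wjk where "Wij u = tri_weight (?a u) (?b u) (?c u) x y z"
    and "Wik u = tri_weight (?a u) (?c u) (?b u) x z y"
    and "Wjk u = tri_weight (?b u) (?c u) (?a u) y z x" for u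
  have ang: "face_angle \<Phi> (radii u) f i = tri_angle (?a u) (?b u) (?c u) x y z"
    "face_angle \<Phi> (radii u) f j = tri_angle (?b u) (?a u) (?c u) y x z"
    "face_angle \<Phi> (radii u) f k = tri_angle (?c u) (?a u) (?b u) z x y" for u
  proof -
    have "f = {j, i, k}" "f = {k, i, j}"
      by (auto simp: fijk)
    then have "face_angle \<Phi> (radii u) f i = inner_angle \<Phi> (radii u) i j k"
      "face_angle \<Phi> (radii u) f j = inner_angle \<Phi> (radii u) j i k"
      "face_angle \<Phi> (radii u) f k = inner_angle \<Phi> (radii u) k i j"
      using d fijk face_angle_eq by metis+
    then show "face_angle \<Phi> (radii u) f i = tri_angle (?a u) (?b u) (?c u) x y z"
      "face_angle \<Phi> (radii u) f j = tri_angle (?b u) (?a u) (?c u) y x z"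
      "face_angle \<Phi> (radii u) f k = tri_angle (?c u) (?a u) (?b u) z x y"
      using c by (simp_all add: inner_angle_eq radii_pos x_def y_def z_def insert_commute)
  qed
  have eq: "face_angles \<Phi> f = (\<lambda>u. tri_angle (?a u) (?b u) (?c u) x y z *\<^sub>R axis i 1
      + tri_angle (?b u) (?a u) (?c u) y x z *\<^sub>R axis j 1
      + tri_angle (?c u) (?a u) (?b u) z x y *\<^sub>R axis k 1)"
  proof (intro ext, subst vec_eq_iff, intro allI)
    fix u l
    show "face_angles \<Phi> f u $ l = (tri_angle (?a u) (?b u) (?c u) x y z *\<^sub>R axis i 1
      + tri_angle (?b u) (?a u) (?c u) y x z *\<^sub>R axis j 1
      + tri_angle (?c u) (?a u) (?b u) z x y *\<^sub>R axis k 1) $ l"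
      using d by (auto simp: face_angles_def ang axis_def fijk[symmetric]) (auto simp: fijk)
  qed
  define D where "D u v =
      (Wij u * (v $ j - v $ i) + Wik u * (v $ k - v $ i)) *\<^sub>R axis i 1
      + (Wij u * (v $ i - v $ j) + Wjk u * (v $ k - v $ j)) *\<^sub>R axis j 1
      + (Wik u * (v $ i - v $ k) + Wjk u * (v $ j - v $ k)) *\<^sub>R axis k (1::real)" for u v
  note dr = radii_has_derivative radii_has_derivative radii_has_derivative radii_pos radii_pos radii_pos
  have der: "(face_angles \<Phi> f has_derivative D u) (at u)" for u
  proof -
    have "((\<lambda>u. tri_angle (?a u) (?b u) (?c u) x y z) has_derivative
        (\<lambda>v. Wij u * (v $ j - v $ i) + Wik u * (v $ k - v $ i))) (at u)"
      using tri_angle_has_derivative[OF dr c] unfolding Wij_def Wik_def .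
    moreover have "((\<lambda>u. tri_angle (?b u) (?a u) (?c u) y x z) has_derivative
        (\<lambda>v. Wij u * (v $ i - v $ j) + Wjk u * (v $ k - v $ j))) (at u)"
      unfolding Wij_def Wjk_def tri_weight_swap[of "?a u" "?b u"]
      by (rule tri_angle_has_derivative[OF dr c(3,4,1,2,5,6)])
    moreover have "((\<lambda>u. tri_angle (?c u) (?a u) (?b u) z x y) has_derivative
        (\<lambda>v. Wik u * (v $ i - v $ k) + Wjk u * (v $ j - v $ k))) (at u)"
      unfolding Wik_def Wjk_def tri_weight_swap[of "?a u" "?c u"]
        tri_weight_swap[of "?b u" "?c u"]
      by (rule tri_angle_has_derivative[OF dr c(5,6,1,2,3,4)])
    ultimately show ?thesis
      unfolding eq D_def
      by (intro has_derivative_add has_derivative_scaleR_left)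
  qed
  have cont: "continuous_on UNIV (\<lambda>u. D u v)" for v
  proof -
    have "continuous_on UNIV Wij" "continuous_on UNIV Wik" "continuous_on UNIV Wjk"
      unfolding Wij_def Wik_def Wjk_def
      using c by (intro continuous_on_tri_weight continuous_on_radii; simp add: radii_pos)+
    then show ?thesis
      unfolding D_def by (intro continuous_intros)
  qed
  \<comment> \<open>The Dirichlet form of the Laplacian: closedness, sign and kernel are all read
    off from it.\<close>
  have form: "D u v \<bullet> w = - (Wij u * ((v $ i - v $ j) * (w $ i - w $ j))
     + Wik u * ((v $ i - v $ k) * (w $ i - w $ k)) + Wjk u * ((v $ j - v $ k) * (w $ j - w $ k)))" for u v w
    unfolding D_def by (simp add: inner_add_left inner_axis' algebra_simps)
  have W: "0 \<le> Wij u" "0 \<le> Wik u" "0 \<le> Wjk u" for u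
    unfolding Wij_def Wik_def Wjk_def
    using c by (intro tri_weight_nonneg radii_pos; simp)+
  have W0: "v $ i = v $ j \<and> v $ i = v $ k" if "D u v \<bullet> v = 0" for u v
  proof -
    have nn: "0 \<le> Wij u * ((v $ i - v $ j) * (v $ i - v $ j))"
      "0 \<le> Wik u * ((v $ i - v $ k) * (v $ i - v $ k))"
      "0 \<le> Wjk u * ((v $ j - v $ k) * (v $ j - v $ k))"
      using W by simp_all
    moreover have "Wij u * ((v $ i - v $ j) * (v $ i - v $ j)) + Wik u * ((v $ i - v $ k) * (v $ i - v $ k))
        + Wjk u * ((v $ j - v $ k) * (v $ j - v $ k)) = 0"
      using that form[of u v v] by linarith
    ultimately have "Wij u * ((v $ i - v $ j) * (v $ i - v $ j)) = 0"
      "Wik u * ((v $ i - v $ k) * (v $ i - v $ k)) = 0"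
      "Wjk u * ((v $ j - v $ k) * (v $ j - v $ k)) = 0"
      by linarith+
    then have z: "Wij u = 0 \<or> v $ i = v $ j" "Wik u = 0 \<or> v $ i = v $ k" "Wjk u = 0 \<or> v $ j = v $ k"
      by simp_all
    \<comment> \<open>A vanishing weight forces cosine 1 on its own edge and 0 on the others. Two
      such patterns conflict, so at least two edges carry positive weight, and they connect the
      three vertices.\<close>
    have "Wij u = 0 \<Longrightarrow> z = 1 \<and> x = 0 \<and> y = 0"
      unfolding Wij_def using tri_weight_eq_0[OF radii_pos radii_pos radii_pos c] by blast
    moreover have "Wik u = 0 \<Longrightarrow> y = 1 \<and> x = 0 \<and> z = 0"
      unfolding Wik_def using tri_weight_eq_0[OF radii_pos radii_pos radii_pos c(1,2,5,6,3,4)] by blast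
    moreover have "Wjk u = 0 \<Longrightarrow> x = 1 \<and> y = 0 \<and> z = 0"
      unfolding Wjk_def using tri_weight_eq_0[OF radii_pos radii_pos radii_pos c(3,4,5,6,1,2)] by blast
    ultimately show ?thesis
      using z by (metis zero_neq_one)
  qed
  have "D u v \<bullet> v \<le> 0" for u v
    unfolding form neg_le_0_iff_le
    by (intro add_nonneg_nonneg mult_nonneg_nonneg W zero_le_square)
  moreover have "\<forall>p\<in>f. \<forall>q\<in>f. v $ p = v $ q" if "D u v \<bullet> v = 0" for u v
    using W0[OF that] by (auto simp: fijk)
  moreover have "closed_form (face_angles \<Phi> f) D"
    unfolding closed_form_def using der cont by (simp add: form algebra_simps)
  ultimately show ?thesis
    by blast
qed

section \<open>The normalised powers of the radii\<close>

text \<open>This is \<open>r\<^sub>i powr \<alpha>\<close> over the sum of all such powers, in the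
  coordinates \<open>u = ln r\<close>; for \<open>\<alpha> > 0\<close> it is the gradient of the
  log-sum-exp function divided by \<open>\<alpha>\<close>.\<close>

definition softmax :: "real \<Rightarrow> real^'v::finite \<Rightarrow> real^'v" where
  "softmax \<alpha> u = (\<chi> i. exp (\<alpha> * u $ i) / (\<Sum>j\<in>UNIV. exp (\<alpha> * u $ j)))"

lemma softmax_nonneg: "0 \<le> softmax \<alpha> u $ i"
  by (simp add: softmax_def sum_nonneg)

lemma sum_exp_pos: "0 < (\<Sum>j\<in>(UNIV::'v::finite set). exp (\<alpha> * u $ j) :: real)"
  by (rule sum_pos) auto

lemma sum_softmax: "(\<Sum>i\<in>UNIV. softmax \<alpha> u $ i) = 1"
  using sum_exp_pos[of \<alpha> u] by (simp add: softmax_def flip: sum_divide_distrib)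

lemma softmax_closed_form:
  "closed_form (softmax \<alpha> :: real^'v::finite \<Rightarrow> real^'v)
     (\<lambda>u v. \<chi> i. \<alpha> * softmax \<alpha> u $ i * (v $ i - softmax \<alpha> u \<bullet> v))"
  unfolding closed_form_def
proof (intro conjI allI)
  fix u v w :: "real^'v"
  let ?Z = "\<lambda>u. \<Sum>j\<in>(UNIV::'v set). exp (\<alpha> * u $ j)"
  have Z: "?Z u \<noteq> 0" for u
    using sum_exp_pos[of \<alpha> u] by simp
  show "(\<chi> i. \<alpha> * softmax \<alpha> u $ i * (v $ i - softmax \<alpha> u \<bullet> v)) \<bullet> w
      = (\<chi> i. \<alpha> * softmax \<alpha> u $ i * (w $ i - softmax \<alpha> u \<bullet> w)) \<bullet> v"
  proof -
    \<comment> \<open>Expanded, the form is \<open>\<alpha>\<close> times the covariance of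
      \<open>v\<close> and \<open>w\<close> under the softmax probabilities, which is visibly
      symmetric.\<close>
    have "(\<chi> i. \<alpha> * softmax \<alpha> u $ i * (v $ i - softmax \<alpha> u \<bullet> v)) \<bullet> w
      = \<alpha> * ((\<Sum>i\<in>UNIV. softmax \<alpha> u $ i * v $ i * w $ i) - (softmax \<alpha> u \<bullet> v) * (softmax \<alpha> u \<bullet> w))" for v w
      by (simp add: inner_vec_def algebra_simps sum_subtractf sum_distrib_left sum_distrib_right)
    then show ?thesis
      by (simp add: mult_ac)
  qed
  have cont: "continuous_on UNIV (\<lambda>u. softmax \<alpha> u $ i)" for i :: 'v
    unfolding softmax_def using Z by (simp; intro continuous_intros) auto
  show "continuous_on UNIV (\<lambda>u. \<chi> i. \<alpha> * softmax \<alpha> u $ i * (v $ i - softmax \<alpha> u \<bullet> v))"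
    unfolding inner_vec_def by (intro continuous_intros cont)
  have exp': "((\<lambda>u. exp (\<alpha> * u $ i)) has_derivative (\<lambda>v. exp (\<alpha> * u $ i) * (\<alpha> * v $ i))) (at u)" for i :: 'v
    by (auto intro!: derivative_eq_intros bounded_linear_imp_has_derivative[OF bounded_linear_vec_nth])
  have comp: "((\<lambda>u. softmax \<alpha> u $ i) has_derivative
       (\<lambda>v. \<alpha> * softmax \<alpha> u $ i * (v $ i - softmax \<alpha> u \<bullet> v))) (at u)" for i
  proof -
    have "((\<lambda>u. exp (\<alpha> * u $ i) / ?Z u) has_derivative
        (\<lambda>v. (exp (\<alpha> * u $ i) * (\<alpha> * v $ i) * ?Z u
            - exp (\<alpha> * u $ i) * (\<Sum>j\<in>UNIV. exp (\<alpha> * u $ j) * (\<alpha> * v $ j))) / (?Z u * ?Z u))) (at u)"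
      by (intro has_derivative_divide' has_derivative_sum exp' Z)
    moreover have "(exp (\<alpha> * u $ i) * (\<alpha> * v $ i) * ?Z u
            - exp (\<alpha> * u $ i) * (\<Sum>j\<in>UNIV. exp (\<alpha> * u $ j) * (\<alpha> * v $ j))) / (?Z u * ?Z u)
        = \<alpha> * softmax \<alpha> u $ i * (v $ i - softmax \<alpha> u \<bullet> v)" for v
    proof -
      have 1: "softmax \<alpha> u \<bullet> v = (\<Sum>j\<in>UNIV. exp (\<alpha> * u $ j) * v $ j) / ?Z u"
        by (simp add: softmax_def inner_vec_def sum_divide_distrib)
      have 2: "(\<Sum>j\<in>UNIV. exp (\<alpha> * u $ j) * (\<alpha> * v $ j)) = \<alpha> * (\<Sum>j\<in>UNIV. exp (\<alpha> * u $ j) * v $ j)"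
        by (simp add: sum_distrib_left mult_ac)
      have 3: "(E * (\<alpha> * p) * Z - E * (\<alpha> * s)) / (Z * Z) = \<alpha> * (E / Z) * (p - s / Z)"
        if "Z \<noteq> 0" for E p Z s :: real
        using that by (simp add: field_simps)
      show ?thesis
        unfolding 1 2 3[OF Z] by (simp add: softmax_def)
    qed
    ultimately show ?thesis
      by (simp add: softmax_def)
  qed
  show "(softmax \<alpha> has_derivative (\<lambda>v. \<chi> i. \<alpha> * softmax \<alpha> u $ i * (v $ i - softmax \<alpha> u \<bullet> v))) (at u)"
    unfolding has_derivative_componentwise_within[where f = "softmax \<alpha>"]
    using comp by (auto simp: Basis_vec_def inner_axis)
qed

text \<open>The form is \<open>\<alpha>\<close> times a variance: deviations from the mean
  \<open>?m\<close> have weighted sum zero, so the factor \<open>v $ i\<close> may be replaced by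
  \<open>v $ i - ?m\<close>.\<close>

lemma softmax_derivative_nonneg:
  fixes u v :: "real^'v::finite"
  assumes "0 \<le> \<alpha>"
  shows "0 \<le> (\<chi> i. \<alpha> * softmax \<alpha> u $ i * (v $ i - softmax \<alpha> u \<bullet> v)) \<bullet> v"
proof -
  let ?m = "softmax \<alpha> u \<bullet> v"
  have "(\<Sum>i\<in>UNIV. softmax \<alpha> u $ i * (v $ i - ?m)) = 0"
    by (simp add: right_diff_distrib sum_subtractf sum_softmax inner_vec_def flip: sum_distrib_right)
  then have "?m * (\<Sum>i\<in>UNIV. softmax \<alpha> u $ i * (v $ i - ?m)) = 0"
    by simp
  then have "(\<Sum>i\<in>UNIV. softmax \<alpha> u $ i * (v $ i - ?m) * ?m) = 0"
    by (simp add: sum_distrib_left mult_ac)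
  then have "(\<Sum>i\<in>UNIV. softmax \<alpha> u $ i * (v $ i - ?m) * v $ i)
      = (\<Sum>i\<in>UNIV. softmax \<alpha> u $ i * (v $ i - ?m) * (v $ i - ?m))"
    by (simp add: right_diff_distrib[of _ _ ?m] sum_subtractf)
  also have "\<dots> \<ge> 0"
    by (intro sum_nonneg) (simp add: softmax_nonneg mult.assoc)
  finally have "0 \<le> \<alpha> * (\<Sum>i\<in>UNIV. softmax \<alpha> u $ i * (v $ i - ?m) * v $ i)"
    using assms by simp
  then show ?thesis
    by (simp add: inner_vec_def sum_distrib_left mult_ac)
qed

section \<open>Connectedness of the triangulation\<close>

text \<open>The sum of the coordinates in \<open>A\<close> is linear, 1 at vertices in
  \<open>A\<close> and 0 at the others. If no face crossed the cut, it would take just these two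
  values on the connected realisation, and by \<open>a\<close> and \<open>b\<close> it takes
  both.\<close>

lemma face_meets_cut:
  fixes F :: "'v::finite set set"
  assumes M: "connected_space M" and tri: "surface_triangulation M F h"
    and A: "a \<in> A" "b \<notin> A"
  shows "\<exists>f\<in>F. f \<inter> A \<noteq> {} \<and> \<not> f \<subseteq> A"
proof (rule ccontr)
  assume neg: "\<not> ?thesis"
  let ?K = "\<Union>f\<in>F. face_simplex f :: (real^'v) set"
  let ?s = "\<lambda>x::real^'v. \<Sum>i\<in>A. x $ i"
  have lin: "linear ?s"
    by (intro linear_compose_sum ballI bounded_linear.linear bounded_linear_vec_nth)
  have s_axis: "?s (axis i 1) = (if i \<in> A then 1 else 0)" for i
    by (simp add: axis_def)
  \<comment> \<open>A linear image of a simplex is the hull of the vertex values, which agree on a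
    face that does not cross the cut.\<close>
  have val: "?s ` face_simplex f \<subseteq> {if f \<subseteq> A then 1 else 0}" if "f \<in> F" for f
  proof -
    have "?s ` face_simplex f = convex hull (?s ` (\<lambda>i. axis i 1) ` f)"
      unfolding face_simplex_def by (rule convex_hull_linear_image[OF lin])
    also have "\<dots> \<subseteq> convex hull {if f \<subseteq> A then 1 else 0}"
    proof (unfold image_image, intro hull_mono image_subsetI)
      fix i
      assume "i \<in> f"
      then have "i \<in> A \<longleftrightarrow> f \<subseteq> A"
        using neg that by blast
      then show "?s (axis i 1) \<in> {if f \<subseteq> A then 1 else 0}"
        by (simp add: s_axis)
    qed
    finally show ?thesis
      by simp
  qed
  have "connected_space (top_of_set ?K)"
    using M tri unfolding surface_triangulation_def
    by (meson homeomorphic_connected_space homeomorphic_map_imp_homeomorphic_space)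
  then have "connected ?K"
    by (simp add: connected_space_subtopology connectedin_def flip: connectedin_iff_connected)
  moreover have "continuous_on ?K ?s"
    by (intro continuous_intros)
  ultimately have conn: "connected (?s ` ?K)"
    by (rule connected_continuous_image[rotated])
  have vert: "axis i 1 \<in> ?K" for i
  proof -
    obtain f where "f \<in> F" "i \<in> f"
      using tri unfolding surface_triangulation_def by blast
    then show ?thesis
      unfolding face_simplex_def by (blast intro: hull_inc)
  qed
  have "1 \<in> ?s ` ?K" "0 \<in> ?s ` ?K"
    using s_axis A vert by (metis (mono_tags, lifting) image_eqI)+
  then have "{0..1} \<subseteq> ?s ` ?K"
    using connected_contains_Icc[OF conn] by blast
  then have "1 / 2 \<in> ?s ` ?K"
    by auto
  moreover have "?s ` ?K \<subseteq> {0, 1}"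
    using val by (force split: if_splits)
  ultimately have "1 / 2 \<in> {0, 1 :: real}"
    by blast
  then show False
    by simp
qed

section \<open>Assembling the Hessian of the potential\<close>

text \<open>Splits the form into a constant, the angle forms and a softmax multiple, so that
  closedness and derivative come summand by summand.\<close>

lemma potential_form_eq:
  fixes F :: "'v::finite set set"
  shows "potential_form F \<Phi> \<beta> \<alpha> = (\<lambda>u. (\<chi> i. 2 * pi + 2 * pi * real (\<beta> i))
      + (- 1) *\<^sub>R (\<Sum>f\<in>F. face_angles \<Phi> f u)
      + (- (2 * pi * of_int (euler_char F))) *\<^sub>R softmax \<alpha> u)"
proof (intro ext, subst vec_eq_iff, intro allI)
  fix u :: "real^'v" and i :: 'v
  have p: "radii u $ j powr \<alpha> = exp (\<alpha> * u $ j)" for j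
    by (simp add: radii_def powr_def)
  have "(\<Sum>f\<in>{f \<in> F. i \<in> f}. face_angle \<Phi> (radii u) f i) = (\<Sum>f\<in>F. face_angles \<Phi> f u $ i)"
    by (simp add: face_angles_def sum.inter_filter)
  then show "potential_form F \<Phi> \<beta> \<alpha> u $ i = ((\<chi> i. 2 * pi + 2 * pi * real (\<beta> i))
      + (- 1) *\<^sub>R (\<Sum>f\<in>F. face_angles \<Phi> f u)
      + (- (2 * pi * of_int (euler_char F))) *\<^sub>R softmax \<alpha> u) $ i"
    by (simp add: potential_form_def curvature_def s_alpha_def p softmax_def)
qed

lemma convex_zero_sum_hyperplane: "convex zero_sum_hyperplane"
  unfolding convex_def zero_sum_hyperplane_def
  by (simp add: sum.distrib flip: sum_distrib_left)

theorem theorem4p1: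
  fixes M :: "'m topology"
    and F :: "'v::finite set set"
    and h :: "real^'v \<Rightarrow> 'm"
    and \<Phi> :: "'v set \<Rightarrow> real"
    and \<beta> :: "'v \<Rightarrow> nat"
    and \<alpha> :: real
    and u0 :: "real^'v"
  assumes "closed_connected_surface M"
    and "surface_triangulation M F h"
    and "weight F \<Phi>"
    and "euler_char F \<le> 0"
    and "branch_structure M F h \<Phi> \<beta>"
    and "\<alpha> \<ge> 0"
  shows "strictly_convex_on zero_sum_hyperplane (branched_potential F \<Phi> \<beta> \<alpha> u0)"
proof -
  have "\<forall>f\<in>F. \<exists>D. closed_form (face_angles \<Phi> f) D \<and> (\<forall>u v. D u v \<bullet> v \<le> 0) \<and>
      (\<forall>u v. D u v \<bullet> v = 0 \<longrightarrow> (\<forall>i\<in>f. \<forall>j\<in>f. v $ i = v $ j))"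
  proof (intro ballI face_angles_closed_form)
    fix f
    assume f: "f \<in> F"
    then show "card f = 3"
      using assms(2) by (simp add: surface_triangulation_def)
    fix e
    assume "card e = 2" "e \<subseteq> f"
    then have "e \<in> edges F"
      using f by (auto simp: edges_def)
    then show "0 \<le> \<Phi> e \<and> \<Phi> e \<le> pi / 2"
      using assms(3) by (simp add: weight_def)
  qed
  then obtain D where all: "\<forall>f\<in>F. closed_form (face_angles \<Phi> f) (D f) \<and> (\<forall>u v. D f u v \<bullet> v \<le> 0) \<and>
      (\<forall>u v. D f u v \<bullet> v = 0 \<longrightarrow> (\<forall>i\<in>f. \<forall>j\<in>f. v $ i = v $ j))"
    by (rule bchoice[THEN exE])
  have D: "closed_form (face_angles \<Phi> f) (D f)"
    and D_le: "D f u v \<bullet> v \<le> 0"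
    and D_eq: "D f u v \<bullet> v = 0 \<Longrightarrow> i \<in> f \<Longrightarrow> j \<in> f \<Longrightarrow> v $ i = v $ j"
    if "f \<in> F" for f u v i j
    using bspec[OF all that] by blast+
  define S where "S u v = (\<chi> i. \<alpha> * softmax \<alpha> u $ i * (v $ i - softmax \<alpha> u \<bullet> v))" for u v :: "real^'v"
  define c where "c = - (2 * pi * of_int (euler_char F))"
  \<comment> \<open>Here the sign of the Euler characteristic enters: the softmax term contributes
    nonnegatively.\<close>
  have "0 \<le> c"
    using assms(4) by (simp add: c_def mult_nonneg_nonpos)
  \<comment> \<open>The summand 0 is the derivative of the constant part, kept so that
    \<open>H\<close> has the shape produced by the closure rules.\<close>
  define H where "H u v = 0 + (- 1) *\<^sub>R (\<Sum>f\<in>F. D f u v) + c *\<^sub>R S u v" for u v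
  have closed: "closed_form (potential_form F \<Phi> \<beta> \<alpha>) H"
    unfolding potential_form_eq H_def c_def S_def
    by (intro closed_form_add closed_form_scaleR closed_form_sum closed_form_const D softmax_closed_form)
  have pos: "0 < H z (y - x) \<bullet> (y - x)"
    if xy: "x \<in> zero_sum_hyperplane" "y \<in> zero_sum_hyperplane" "x \<noteq> y" for x y z
  proof -
    define v where "v = y - x"
    have sum_v: "(\<Sum>i\<in>UNIV. v $ i) = 0" and "v \<noteq> 0"
      using xy by (simp_all add: v_def zero_sum_hyperplane_def sum_subtractf)
    \<comment> \<open>A constant vector with zero sum would be zero.\<close>
    then obtain a b where ab: "v $ a \<noteq> v $ b"
      by (metis (mono_tags, lifting) UNIV_I card_gt_0_iff finite mult_eq_0_iff of_nat_eq_0_iff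
          empty_iff less_irrefl sum.cong sum_constant vec_eq_iff zero_index)
    \<comment> \<open>Cutting along the level set of \<open>v\<close> through \<open>a\<close>
      yields a face on which \<open>v\<close> is not constant; its Dirichlet form is then positive,
      and no other face subtracts from it.\<close>
    obtain f where "f \<in> F" "f \<inter> {i. v $ i = v $ a} \<noteq> {}" "\<not> f \<subseteq> {i. v $ i = v $ a}"
      using face_meets_cut[of M F h a "{i. v $ i = v $ a}" b] assms(1,2) ab
      unfolding closed_connected_surface_def by auto
    then obtain i j where "i \<in> f" "v $ i = v $ a" "j \<in> f" "v $ j \<noteq> v $ a"
      by blast
    then have f: "f \<in> F" "i \<in> f" "j \<in> f" "v $ i \<noteq> v $ j"
      using \<open>f \<in> F\<close> by simp_all
    have "D f z v \<bullet> v \<noteq> 0"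
      using D_eq[OF f(1) _ f(2,3)] f(4) by blast
    then have "0 < (\<Sum>f\<in>F. - (D f z v \<bullet> v))"
      using f(1) D_le by (intro sum_pos2[of F f]) (auto simp: order_less_le)
    moreover have "0 \<le> c * (S z v \<bullet> v)"
      unfolding S_def by (intro mult_nonneg_nonneg \<open>0 \<le> c\<close> softmax_derivative_nonneg assms(6))
    ultimately have "0 < H z v \<bullet> v"
      by (simp add: H_def inner_add_left inner_sum_left inner_diff_left sum_negf)
    then show ?thesis
      by (simp add: v_def)
  qed
  obtain G where G: "\<And>u. (G has_derivative (\<lambda>v. potential_form F \<Phi> \<beta> \<alpha> u \<bullet> v)) (at u)"
    using closed_form_potential[OF closed] by blast
  \<comment> \<open>The base point only shifts the potential by a constant.\<close>
  have "branched_potential F \<Phi> \<beta> \<alpha> u0 = (\<lambda>u. G u - G u0)"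
    unfolding branched_potential_def by (intro ext the_line_integral G)
  moreover have "(potential_form F \<Phi> \<beta> \<alpha> has_derivative H u) (at u)" for u
    using closed by (simp add: closed_form_def)
  ultimately show ?thesis
    by (simp only:) (rule strictly_convex_on_gradient[OF convex_zero_sum_hyperplane G _ pos])
qed

end
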